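(* In the mobile telephone model with tag length $b=1$ and any stability factor $\tau\ge1$, and with shared randomness available to all nodes, the SharedBit gossip algorithm solves the gossip problem in $O(kn)$ rounds, where $n$ is the network size and $k$ is the number of tokens.
   Context: Mobile telephone model. Time proceeds in synchronous rounds $1,2,\dots$, and all nodes start in round 1. The topology is a dynamic graph $G_1,G_2,\dots$ fixed before the execution begins, where each $G_r=(V,E_r)$ is a connected undirected graph on the same node set $V$, $|V|=n>1$. Stability factor $\tau\ge1$: at least $\tau$ rounds pass between any two changes of the topology ($\tau=1$: it may change arbitrarily every round; $\tau=\infty$: it never changes). At the beginning of round $r$ each node selects a tag of $b$ bits to advertise, then learns its neighbor set in $G_r$ and the tags of its neighbors. Each node may then send a connection proposal to at most one neighbor. A node that sends a proposal cannot receive one; a node that does not send a proposal and receives at least one proposal accepts one chosen uniformly at random among those received. A proposer and acceptor are then connected for the round and may exchange at most $O(1)$ tokens and $O(\mathrm{polylog}(N))$ additional bits. Gossip problem. Each node knows an upper bound $N\ge n$ and has a unique ID in $[N]=\{1,\dots,N\}$. There are $k$ tokens, $1\le k\le n$ ($k$ is not known to the nodes), each initially held by exactly one node; tokens are black boxes, labelled by distinct elements of $[N]$ (which orders them), that can only be passed through connections. $T_u(r)$ is the set of tokens known by $u$ at the beginning of round $r$. An algorithm solves gossip in $f$ rounds if, with probability at least $1-1/n$, all nodes know all $k$ tokens by round $f$. $O(\cdot)$ is asymptotic with universal constants. Transfer$(\varepsilon)$ subroutine. Run by two connected nodes $u,v$ with token sets $T_u,T_v$ (using fresh private randomness); if $T_u\ne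 T_v$, then with probability at least $1-\varepsilon$ the smallest token in $(T_u\cup T_v)\setminus(T_u\cap T_v)$ is transferred by the node that knows it to the node that does not. In all cases nodes only gain tokens that the other node knows. SharedBit. All nodes have access to a common uniformly random bit string $\hat r$ of length $cN^3(\lceil\log N\rceil+1)$, partitioned into $cN^2$ groups labelled $1,\dots,cN^2$, each consisting of $N$ bundles labelled $1,\dots,N$ of $\lceil\log N\rceil+1$ bits each. In round $r\le cN^2$, for each token $t\in T_u(r)$ let $t.\mathrm{bit}$ be the first bit of bundle $t$ of group $r$. Node $u$ advertises $b_u(r)=\left(\sum_{t\in T_u(r)}t.\mathrm{bit}\right)\bmod 2$ (and $b_u(r)=0$ if $T_u(r)=\emptyset$). If $b_u(r)=0$, $u$ sends no proposal and waits to receive proposals. If $b_u(r)=1$ and $u$ has at least one neighbor advertising $0$, then $u$ chooses one of these neighbors uniformly at random (the choice being made with the remaining $\lceil\log N\rceil$ bits of the bundle of group $r$ labelled by $u$'s ID, and treated as uniform) and sends it a proposal. Two nodes that connect run Transfer$(n^{-c_t})$. Here $c,c_t\ge1$ are sufficiently large constants. After round $cN^2$ the behavior is arbitrary. *)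

theory Defs
  imports "HOL-Probability.Probability" "HOL-Library.Extended_Nat"
begin

section \<open>Dynamic topologies\<close>

text \<open>
  Nodes are identified with their unique IDs, and tokens with their labels, so that both are
  elements of \<open>{1..N}\<close>. An undirected graph is a symmetric irreflexive relation on the node set.
\<close>

definition connected_graph :: "nat set \<Rightarrow> nat rel \<Rightarrow> bool" where
  "connected_graph V E \<longleftrightarrow>
     E \<subseteq> V \<times> V \<and> sym E \<and> irrefl E \<and> (\<forall>u\<in>V. \<forall>v\<in>V. (u, v) \<in> E\<^sup>*)"

definition dynamic_graph :: "nat set \<Rightarrow> (nat \<Rightarrow> nat rel) \<Rightarrow> bool" where
  "dynamic_graph V E \<longleftrightarrow> (\<forall>r\<ge>1. connected_graph V (E r))"

text \<open>
  The topology changes after round \<open>r\<close> if \<open>E (Suc r) \<noteq> E r\<close>. For \<open>\<tau> = \<infinity>\<close> the condition on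
  pairs of changes would still permit a single change, so that case is stated separately.
\<close>

definition stability_factor :: "enat \<Rightarrow> (nat \<Rightarrow> nat rel) \<Rightarrow> bool" where
  "stability_factor \<tau> E \<longleftrightarrow>
     (\<forall>r r'. 1 \<le> r \<and> r < r' \<and> E (Suc r) \<noteq> E r \<and> E (Suc r') \<noteq> E r' \<longrightarrow> \<tau> \<le> enat (r' - r)) \<and>
     (\<tau> = \<infinity> \<longrightarrow> (\<forall>r\<ge>1. E r = E 1))"


section \<open>Mobile telephone model\<close>

text \<open>A configuration assigns to each node the set of tokens it knows.\<close>

type_synonym config = "nat \<Rightarrow> nat set"

text \<open>
  What a node sees after the tags have been advertised: the domain is its neighbor set, the
  values are the tags of its neighbors.
\<close>

definition neighbor_view :: "nat rel \<Rightarrow> (nat \<Rightarrow> 'tag) \<Rightarrow> nat \<Rightarrow> (nat \<rightharpoonup> 'tag)" where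
  "neighbor_view E tag u = (\<lambda>v. if (u, v) \<in> E then Some (tag v) else None)"

text \<open>
  Here \<open>p u = Some v\<close> means that \<open>u\<close> sends a proposal to \<open>v\<close>, and the result \<open>Some u\<close> for \<open>v\<close>
  means that \<open>v\<close> accepts the proposal of \<open>u\<close>.
\<close>

definition accept :: "nat rel \<Rightarrow> (nat \<Rightarrow> nat option) \<Rightarrow> nat \<Rightarrow> nat option pmf" where
  "accept E p v =
     (let R = {u. (u, v) \<in> E \<and> p u = Some v}
      in if p v = None \<and> R \<noteq> {} then map_pmf Some (pmf_of_set R) else return_pmf None)"

text \<open>
  One round on topology \<open>E\<close>: all nodes propose independently, then all nodes accept independently,
  then all connected pairs exchange tokens independently. Every connection is indexed by its
  acceptor; \<open>exch u v A B\<close> yields the new token sets of the proposer \<open>u\<close> and the acceptor \<open>v\<close>,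
  whose old ones are \<open>A\<close> and \<open>B\<close>. With tag length 1, \<open>'tag\<close> is \<open>bool\<close>.
\<close>

definition mtm_round ::
  "nat set \<Rightarrow> nat rel \<Rightarrow> (nat \<Rightarrow> nat set \<Rightarrow> 'tag) \<Rightarrow>
   (nat \<Rightarrow> nat set \<Rightarrow> (nat \<rightharpoonup> 'tag) \<Rightarrow> nat option pmf) \<Rightarrow>
   (nat \<Rightarrow> nat \<Rightarrow> nat set \<Rightarrow> nat set \<Rightarrow> (nat set \<times> nat set) pmf) \<Rightarrow>
   config \<Rightarrow> config pmf" where
  "mtm_round V E advertise propose exch T =
     do {
       p \<leftarrow> Pi_pmf V None
              (\<lambda>u. propose u (T u) (neighbor_view E (\<lambda>v. advertise v (T v)) u));
       a \<leftarrow> Pi_pmf V None (accept E p);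
       x \<leftarrow> Pi_pmf V ({}, {})
              (\<lambda>v. case a v of None \<Rightarrow> return_pmf ({}, {}) | Some u \<Rightarrow> exch u v (T u) (T v));
       return_pmf (\<lambda>w.
         case a w of
           Some u \<Rightarrow> snd (x w)
         | None \<Rightarrow>
             (case p w of
                Some v \<Rightarrow> if a v = Some w then fst (x v) else T w
              | None \<Rightarrow> T w))
     }"


section \<open>Gossip\<close>

definition gossip_instance :: "nat \<Rightarrow> nat set \<Rightarrow> nat set \<Rightarrow> config \<Rightarrow> bool" where
  "gossip_instance N V K T \<longleftrightarrow>
     V \<subseteq> {1..N} \<and> K \<subseteq> {1..N} \<and> (\<forall>u\<in>V. T u \<subseteq> K) \<and> (\<forall>t\<in>K. \<exists>!u. u \<in> V \<and> t \<in> T u)"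

text \<open>\<open>run f\<close> is the distribution of the configuration after the first \<open>f\<close> rounds.\<close>

definition solves_gossip :: "nat set \<Rightarrow> nat set \<Rightarrow> (nat \<Rightarrow> config pmf) \<Rightarrow> nat \<Rightarrow> bool" where
  "solves_gossip V K run f \<longleftrightarrow>
     measure_pmf.prob (run f) {T. \<forall>u\<in>V. K \<subseteq> T u} \<ge> 1 - 1 / real (card V)"


section \<open>Transfer and SharedBit\<close>

definition transfer_subroutine ::
  "nat \<Rightarrow> real \<Rightarrow> (nat \<Rightarrow> nat \<Rightarrow> nat set \<Rightarrow> nat set \<Rightarrow> (nat set \<times> nat set) pmf) \<Rightarrow> bool" where
  "transfer_subroutine N \<epsilon> transfer \<longleftrightarrow>
     (\<forall>u\<in>{1..N}. \<forall>v\<in>{1..N}. \<forall>A B. u \<noteq> v \<and> A \<subseteq> {1..N} \<and> B \<subseteq> {1..N} \<longrightarrow>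
        (\<forall>(A', B') \<in> set_pmf (transfer u v A B).
           A \<subseteq> A' \<and> A' \<subseteq> A \<union> B \<and> B \<subseteq> B' \<and> B' \<subseteq> A \<union> B) \<and>
        (A \<noteq> B \<longrightarrow>
           measure_pmf.prob (transfer u v A B)
             {(A', B'). Min ((A \<union> B) - (A \<inter> B)) \<in> A' \<inter> B'} \<ge> 1 - \<epsilon>))"

text \<open>
  The shared string has one bit for every group in \<open>{1..c * N\<^sup>2}\<close>, bundle in \<open>{1..N}\<close> and position
  in \<open>{0..\<lceil>log 2 N\<rceil>}\<close>, which makes \<open>c * N ^ 3 * (\<lceil>log 2 N\<rceil> + 1)\<close> bits; \<open>\<omega> (r, t, 0)\<close> is the first bit
  of bundle \<open>t\<close> of group \<open>r\<close>.
\<close>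

type_synonym bit_string = "nat \<times> nat \<times> nat \<Rightarrow> bool"

definition shared_string :: "nat \<Rightarrow> nat \<Rightarrow> bit_string pmf" where
  "shared_string c N =
     pmf_of_set (PiE_dflt ({1..c * N\<^sup>2} \<times> {1..N} \<times> {0..nat \<lceil>log 2 (real N)\<rceil>}) False (\<lambda>_. UNIV))"

definition sharedbit_tag :: "bit_string \<Rightarrow> nat \<Rightarrow> nat \<Rightarrow> nat set \<Rightarrow> bool" where
  "sharedbit_tag \<omega> r u A \<longleftrightarrow> (\<Sum>t\<in>A. of_bool (\<omega> (r, t, 0))) mod 2 = (1::nat)"

text \<open>
  The choice that \<open>u\<close> makes with positions \<open>1, \<dots>, \<lceil>log 2 N\<rceil>\<close> of bundle \<open>u\<close> of group \<open>r\<close>, bits that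
  are used nowhere else, is treated as uniform: it is modelled by an independent uniform choice.
\<close>

definition sharedbit_propose ::
  "bit_string \<Rightarrow> nat \<Rightarrow> nat \<Rightarrow> nat set \<Rightarrow> (nat \<rightharpoonup> bool) \<Rightarrow> nat option pmf" where
  "sharedbit_propose \<omega> r u A view =
     (let Z = {v. view v = Some False}
      in if sharedbit_tag \<omega> r u A \<and> Z \<noteq> {} then map_pmf Some (pmf_of_set Z)
         else return_pmf None)"

definition sharedbit_round ::
  "nat set \<Rightarrow> nat rel \<Rightarrow> (nat \<Rightarrow> nat \<Rightarrow> nat set \<Rightarrow> nat set \<Rightarrow> (nat set \<times> nat set) pmf) \<Rightarrow>
   bit_string \<Rightarrow> nat \<Rightarrow> config \<Rightarrow> config pmf" where
  "sharedbit_round V E transfer \<omega> r =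
     mtm_round V E (sharedbit_tag \<omega> r) (sharedbit_propose \<omega> r) transfer"

text \<open>
  The configuration after a number of rounds, for a fixed shared string. The kernel \<open>late\<close> is the
  arbitrary behavior after round \<open>c * N\<^sup>2\<close>. It may depend on the round, the shared string and the
  current configuration; every process has the same distribution of the configuration at any one
  time as one of this form.
\<close>

primrec sharedbit_config ::
  "nat \<Rightarrow> nat \<Rightarrow> nat set \<Rightarrow> (nat \<Rightarrow> nat rel) \<Rightarrow>
   (nat \<Rightarrow> nat \<Rightarrow> nat set \<Rightarrow> nat set \<Rightarrow> (nat set \<times> nat set) pmf) \<Rightarrow>
   (nat \<Rightarrow> bit_string \<Rightarrow> config \<Rightarrow> config pmf) \<Rightarrow> config \<Rightarrow> bit_string \<Rightarrow> nat \<Rightarrow> config pmf" where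
  "sharedbit_config c N V E transfer late T1 \<omega> 0 = return_pmf T1"
| "sharedbit_config c N V E transfer late T1 \<omega> (Suc r) =
     do {
       T \<leftarrow> sharedbit_config c N V E transfer late T1 \<omega> r;
       if Suc r \<le> c * N\<^sup>2 then sharedbit_round V (E (Suc r)) transfer \<omega> (Suc r) T
       else late (Suc r) \<omega> T
     }"

definition sharedbit_run ::
  "nat \<Rightarrow> nat \<Rightarrow> nat set \<Rightarrow> (nat \<Rightarrow> nat rel) \<Rightarrow>
   (nat \<Rightarrow> nat \<Rightarrow> nat set \<Rightarrow> nat set \<Rightarrow> (nat set \<times> nat set) pmf) \<Rightarrow>
   (nat \<Rightarrow> bit_string \<Rightarrow> config \<Rightarrow> config pmf) \<Rightarrow> config \<Rightarrow> nat \<Rightarrow> config pmf" where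
  "sharedbit_run c N V E transfer late T1 f =
     do {
       \<omega> \<leftarrow> shared_string c N;
       sharedbit_config c N V E transfer late T1 \<omega> f
     }"

end

theory Submission
  imports Defs
begin

text \<open>
  As long as gossip is unfinished, connectivity yields an edge whose endpoints know different token
  sets. The shared bits of the round are fresh, so with probability \<open>1/2\<close> the tags of these
  endpoints differ; then some node proposes to a neighbor advertising \<open>0\<close>, and whichever proposal
  that neighbor accepts comes from a node advertising \<open>1\<close>, that is, with another token set.
  Transfer succeeds with probability at least \<open>1/2\<close>, so each round lowers the number of missing
  (node, token) pairs \<open>\<Phi> \<le> k n\<close> with probability at least \<open>1/4\<close>. Hence \<open>2 ^ \<Phi>\<close> shrinks in expectation
  by the factor \<open>7/8\<close> per round, and \<open>(7/8) ^ 12 * 2 \<le> 1/2\<close> makes \<open>12 k n\<close> rounds enough.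
\<close>

section \<open>Kernels and potentials\<close>

text \<open>Chains success probabilities: outside \<open>D\<close> the second stage is bounded below
  by 0, so it has to be controlled only after a good first stage.\<close>

lemma prob_bind_pmf_ge:
  assumes "\<And>x. x \<in> set_pmf M \<Longrightarrow> x \<in> D \<Longrightarrow> a \<le> measure_pmf.prob (f x) S" and "0 \<le> a"
  shows "measure_pmf.prob M D * a \<le> measure_pmf.prob (bind_pmf M f) S"
proof -
  have "ennreal (measure_pmf.prob M D * a) = (\<integral>\<^sup>+x. ennreal a * indicator D x \<partial>M)"
    using assms(2) by (simp add: nn_integral_cmult measure_pmf.emeasure_eq_measure
        flip: ennreal_mult'')
  also have "\<dots> \<le> (\<integral>\<^sup>+x. emeasure (f x) S \<partial>M)"
    using assms
    by (intro nn_integral_mono_AE)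
       (auto simp: AE_measure_pmf_iff indicator_def measure_pmf.emeasure_eq_measure)
  also have "\<dots> = ennreal (measure_pmf.prob (bind_pmf M f) S)"
    by (simp flip: measure_pmf.emeasure_eq_measure)
  finally show ?thesis
    by simp
qed

corollary prob_bind_pmf_ge_UNIV:
  assumes "\<And>x. x \<in> set_pmf M \<Longrightarrow> a \<le> measure_pmf.prob (f x) S" and "0 \<le> a"
  shows "a \<le> measure_pmf.prob (bind_pmf M f) S"
  using prob_bind_pmf_ge[of M UNIV a f S] assms by simp

text \<open>The potential is a natural number, so each drop is by at least one and halves the weight
  \<open>2 ^ \<Phi> x\<close>. As it never rises, one step multiplies the expected weight by at most
  \<open>p / 2 + (1 - p) = 1 - p / 2\<close>. Markov's inequality turns the expectation into a tail
  bound.\<close>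

lemma potential_tail_bound:
  fixes \<Phi> :: "'a \<Rightarrow> nat" and p :: real
  assumes init: "P 0 = return_pmf x0" "I x0"
    and chain: "\<And>r. r < f \<Longrightarrow> P (Suc r) = bind_pmf (P r) (Q r)"
    and step: "\<And>r x y. r < f \<Longrightarrow> I x \<Longrightarrow> y \<in> set_pmf (Q r x) \<Longrightarrow> I y \<and> \<Phi> y \<le> \<Phi> x"
    and drop: "\<And>r x. r < f \<Longrightarrow> I x \<Longrightarrow> 0 < \<Phi> x \<Longrightarrow>
                 p \<le> measure_pmf.prob (Q r x) {y. \<Phi> y < \<Phi> x}"
    and p: "0 \<le> p" "p \<le> 1"
  shows "measure_pmf.prob (P f) {x. 0 < \<Phi> x} \<le> (1 - p / 2) ^ f * 2 ^ \<Phi> x0"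
proof -
  \<comment> \<open>Cutting the weight off at potential zero makes the drift bound valid there as well.\<close>
  define g :: "'a \<Rightarrow> real" where "g x = (if \<Phi> x = 0 then 0 else 2 ^ \<Phi> x)" for x
  have g_nonneg: "0 \<le> g x" for x
    by (simp add: g_def)
  have drift: "(\<integral>\<^sup>+y. ennreal (g y) \<partial>Q r x) \<le> ennreal ((1 - p / 2) * g x)" if "r < f" "I x" for r x
  proof (cases "\<Phi> x = 0")
    case True
    then have "(\<integral>\<^sup>+y. ennreal (g y) \<partial>Q r x) = (\<integral>\<^sup>+y. 0 \<partial>Q r x)"
      using step[OF that] by (intro nn_integral_cong_AE) (auto simp: AE_measure_pmf_iff g_def)
    then show ?thesis
      by simp
  next
    case False
    define D where "D = {y. \<Phi> y < \<Phi> x}"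
    have D: "p \<le> measure_pmf.prob (Q r x) D"
      unfolding D_def using drop that False by simp
    have "g y \<le> g x / 2 + g x / 2 * indicator (- D) y" if "y \<in> set_pmf (Q r x)" for y
    proof (cases "y \<in> D")
      case True
      then have "Suc (\<Phi> y) \<le> \<Phi> x"
        by (simp add: D_def)
      then have "(2::real) ^ Suc (\<Phi> y) \<le> 2 ^ \<Phi> x"
        by (intro power_increasing) auto
      with True False show ?thesis
        by (simp add: g_def)
    next
      case nD: False
      then have "\<Phi> y = \<Phi> x"
        using step[OF \<open>r < f\<close> \<open>I x\<close> that] by (simp add: D_def)
      with nD show ?thesis
        by (simp add: g_def)
    qed
    then have "(\<integral>\<^sup>+y. ennreal (g y) \<partial>Q r x)
        \<le> (\<integral>\<^sup>+y. ennreal (g x / 2) + ennreal (g x / 2) * indicator (- D) y \<partial>Q r x)"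
      using g_nonneg[of x]
      by (intro nn_integral_mono_AE)
         (fastforce simp: AE_measure_pmf_iff indicator_def simp flip: ennreal_plus
           intro!: ennreal_leI split: if_splits)
    also have "\<dots> = ennreal (g x / 2 + g x / 2 * measure_pmf.prob (Q r x) (- D))"
      using g_nonneg[of x]
      by (simp add: nn_integral_add nn_integral_cmult measure_pmf.emeasure_eq_measure
          flip: ennreal_mult'' ennreal_plus)
    also have "\<dots> \<le> ennreal ((1 - p / 2) * g x)"
    proof (rule ennreal_leI)
      have "measure_pmf.prob (Q r x) (- D) \<le> 1 - p"
        using D measure_pmf.prob_compl[of D "Q r x"] by (simp add: Compl_eq_Diff_UNIV)
      then have "g x / 2 * measure_pmf.prob (Q r x) (- D) \<le> g x / 2 * (1 - p)"
        using g_nonneg[of x] by (intro mult_left_mono) auto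
      then show "g x / 2 + g x / 2 * measure_pmf.prob (Q r x) (- D) \<le> (1 - p / 2) * g x"
        by (simp add: field_simps)
    qed
    finally show ?thesis .
  qed
  \<comment> \<open>The drift bound holds only where \<open>I\<close> does, so the invariant on the
    support is carried through the same induction.\<close>
  have "(\<forall>x\<in>set_pmf (P r). I x) \<and>
      (\<integral>\<^sup>+x. ennreal (g x) \<partial>P r) \<le> ennreal ((1 - p / 2) ^ r * 2 ^ \<Phi> x0)" if "r \<le> f" for r
    using that
  proof (induction r)
    case 0
    then show ?case
      by (auto simp: init g_def nn_integral_return_pmf intro!: ennreal_leI)
  next
    case (Suc r)
    then have r: "r < f" and IH1: "\<forall>x\<in>set_pmf (P r). I x"
      and IH2: "(\<integral>\<^sup>+x. ennreal (g x) \<partial>P r) \<le> ennreal ((1 - p / 2) ^ r * 2 ^ \<Phi> x0)"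
      by auto
    have "(\<integral>\<^sup>+x. ennreal (g x) \<partial>P (Suc r)) = (\<integral>\<^sup>+x. \<integral>\<^sup>+y. ennreal (g y) \<partial>Q r x \<partial>P r)"
      by (simp add: chain[OF r])
    also have "\<dots> \<le> (\<integral>\<^sup>+x. ennreal (1 - p / 2) * ennreal (g x) \<partial>P r)"
      using IH1 drift[OF r] p g_nonneg
      by (intro nn_integral_mono_AE) (auto simp: AE_measure_pmf_iff ennreal_mult')
    also have "\<dots> = ennreal (1 - p / 2) * (\<integral>\<^sup>+x. ennreal (g x) \<partial>P r)"
      by (simp add: nn_integral_cmult)
    also have "\<dots> \<le> ennreal (1 - p / 2) * ennreal ((1 - p / 2) ^ r * 2 ^ \<Phi> x0)"
      using IH2 by (rule mult_left_mono) simp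
    also have "\<dots> = ennreal ((1 - p / 2) ^ Suc r * 2 ^ \<Phi> x0)"
      using p by (simp add: mult.assoc flip: ennreal_mult')
    finally show ?case
      using IH1 step[OF r] by (auto simp: chain[OF r])
  qed
  then have bound: "(\<integral>\<^sup>+x. ennreal (g x) \<partial>P f) \<le> ennreal ((1 - p / 2) ^ f * 2 ^ \<Phi> x0)"
    by blast
  \<comment> \<open>Markov's inequality with threshold 1: where the potential is positive,
    \<open>g\<close> is at least 2.\<close>
  have "ennreal (measure_pmf.prob (P f) {x. 0 < \<Phi> x}) = (\<integral>\<^sup>+x. indicator {x. 0 < \<Phi> x} x \<partial>P f)"
    by (simp add: measure_pmf.emeasure_eq_measure)
  also have "\<dots> \<le> (\<integral>\<^sup>+x. ennreal (g x) \<partial>P f)"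
    by (intro nn_integral_mono) (auto simp: indicator_def g_def)
  also note bound
  finally show ?thesis
    using p by (simp add: ennreal_le_iff)
qed


section \<open>The shared string\<close>

definition string_index :: "nat \<Rightarrow> nat \<Rightarrow> (nat \<times> nat \<times> nat) set" where
  "string_index c N = {1..c * N\<^sup>2} \<times> {1..N} \<times> {0..nat \<lceil>log 2 (real N)\<rceil>}"

lemma finite_string_index: "finite (string_index c N)"
  by (simp add: string_index_def)

lemma shared_string_eq_Pi_pmf:
  "shared_string c N = Pi_pmf (string_index c N) False (\<lambda>_. pmf_of_set UNIV)"
  unfolding shared_string_def string_index_def by (subst Pi_pmf_of_set) auto

text \<open>\<open>F\<close> reads only groups up to \<open>r\<close> and \<open>H\<close> only
  later ones. These two parts of the string are independent, so the second stage may draw a fresh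
  string without changing the distribution.\<close>

lemma bind_shared_string_resample:
  assumes F: "\<And>\<omega> \<omega>'. (\<And>q t i. q \<le> r \<Longrightarrow> \<omega> (q, t, i) = \<omega>' (q, t, i)) \<Longrightarrow> F \<omega> = F \<omega>'"
    and H: "\<And>\<omega> \<omega>' x. (\<And>q t i. r < q \<Longrightarrow> \<omega> (q, t, i) = \<omega>' (q, t, i)) \<Longrightarrow> H \<omega> x = H \<omega>' x"
  shows "bind_pmf (shared_string c N) (\<lambda>\<omega>. bind_pmf (F \<omega>) (H \<omega>)) =
    bind_pmf (bind_pmf (shared_string c N) F) (\<lambda>x. bind_pmf (shared_string c N) (\<lambda>\<omega>. H \<omega> x))"
proof -
  define A where "A = {i \<in> string_index c N. fst i \<le> r}"
  define B where "B = {i \<in> string_index c N. r < fst i}"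
  define PA where "PA = Pi_pmf A False (\<lambda>_. pmf_of_set (UNIV :: bool set))"
  define PB where "PB = Pi_pmf B False (\<lambda>_. pmf_of_set (UNIV :: bool set))"
  define merge :: "bit_string \<Rightarrow> bit_string \<Rightarrow> bit_string"
    where "merge x y i = (if i \<in> A then x i else y i)" for x y i
  have fin: "finite A" "finite B"
    by (simp_all add: A_def B_def finite_string_index)
  have "string_index c N = A \<union> B" "A \<inter> B = {}"
    by (auto simp: A_def B_def)
  then have split: "shared_string c N = map_pmf (\<lambda>(x, y). merge x y) (pair_pmf PA PB)"
    unfolding shared_string_eq_Pi_pmf PA_def PB_def merge_def
    by (simp add: Pi_pmf_union[OF fin])
  have default: "x i = False" if "x \<in> set_pmf (Pi_pmf J False (\<lambda>_. pmf_of_set (UNIV :: bool set)))"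
      "finite J" "i \<notin> J" for x J and i :: "nat \<times> nat \<times> nat"
    using set_Pi_pmf_subset[OF that(2), of False "\<lambda>_. pmf_of_set (UNIV :: bool set)"] that
    by (cases i) auto
  \<comment> \<open>At a position of a group up to \<open>r\<close> outside \<open>A\<close>,
    \<open>merge\<close> reads \<open>y\<close>; such a position lies in neither \<open>A\<close>
    nor \<open>B\<close>, so both strings hold the default \<open>False\<close> there.\<close>
  have F_merge: "F (merge x y) = F x" if "x \<in> set_pmf PA" "y \<in> set_pmf PB" for x y
    using default[OF that(1)[unfolded PA_def] fin(1)] default[OF that(2)[unfolded PB_def] fin(2)]
    by (intro F) (auto simp: merge_def B_def)
  have H_merge: "H (merge x y) = H y" for x y
    by (rule ext, rule H) (auto simp: merge_def A_def)
  have bind_shared: "bind_pmf (shared_string c N) G =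
      bind_pmf PA (\<lambda>x. bind_pmf PB (\<lambda>y. G (merge x y)))" for G :: "bit_string \<Rightarrow> 'c pmf"
    unfolding split by (simp add: bind_map_pmf pair_pmf_def bind_assoc_pmf bind_return_pmf)
  have F': "bind_pmf (shared_string c N) F = bind_pmf PA F"
    unfolding bind_shared by (rule bind_pmf_cong[OF refl]) (simp add: F_merge cong: bind_pmf_cong_simp)
  have H': "bind_pmf (shared_string c N) (\<lambda>\<omega>. H \<omega> x) = bind_pmf PB (\<lambda>\<omega>. H \<omega> x)" for x
    unfolding bind_shared by (simp add: H_merge)
  have "bind_pmf (shared_string c N) (\<lambda>\<omega>. bind_pmf (F \<omega>) (H \<omega>)) =
      bind_pmf PA (\<lambda>x. bind_pmf PB (\<lambda>y. bind_pmf (F x) (H y)))"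
    unfolding bind_shared by (intro bind_pmf_cong refl) (simp_all add: F_merge H_merge)
  \<comment> \<open>The first stage no longer involves \<open>y\<close>, so drawing the later half
    can be postponed until after it.\<close>
  also have "\<dots> = bind_pmf PA (\<lambda>x. bind_pmf (F x) (\<lambda>z. bind_pmf PB (\<lambda>y. H y z)))"
    by (subst bind_commute_pmf) simp
  finally show ?thesis
    unfolding F' H' bind_assoc_pmf .
qed

section \<open>Parity tags under a flip of one shared bit\<close>

lemma sharedbit_tag_flip:
  assumes "finite A" "t \<in> A"
  shows "sharedbit_tag (s((r, t, 0) := (\<not> s (r, t, 0)))) r u A \<longleftrightarrow> \<not> sharedbit_tag s r u A"
proof -
  let ?s' = "s((r, t, 0) := (\<not> s (r, t, 0)))"
  have flipped: "(\<Sum>q\<in>A. of_bool (?s' (r, q, 0)) :: nat) =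
      of_bool (\<not> s (r, t, 0)) + (\<Sum>q\<in>A - {t}. of_bool (s (r, q, 0)))"
    by (subst sum.remove[OF assms]) (auto intro!: sum.cong)
  have orig: "(\<Sum>q\<in>A. of_bool (s (r, q, 0)) :: nat) =
      of_bool (s (r, t, 0)) + (\<Sum>q\<in>A - {t}. of_bool (s (r, q, 0)))"
    using assms by (rule sum.remove)
  show ?thesis
    unfolding sharedbit_tag_def flipped orig by (cases "s (r, t, 0)"; simp; presburger?)
qed

lemma sharedbit_tag_upd_other:
  assumes "t \<notin> A"
  shows "sharedbit_tag (s((r, t, 0) := b)) r u A = sharedbit_tag s r u A"
proof -
  have "(\<Sum>q\<in>A. of_bool ((s((r, t, 0) := b)) (r, q, 0)) :: nat) = (\<Sum>q\<in>A. of_bool (s (r, q, 0)))"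
    using assms by (intro sum.cong) auto
  then show ?thesis
    unfolding sharedbit_tag_def by simp
qed

text \<open>The flip is an involution of the finite set of strings, hence a bijection, and
  bijections preserve the uniform distribution.\<close>

lemma map_shared_string_flip:
  assumes "i \<in> string_index c N"
  shows "map_pmf (\<lambda>s. s(i := (\<not> s i))) (shared_string c N) = shared_string c N"
proof -
  let ?S = "PiE_dflt (string_index c N) False (\<lambda>_. UNIV :: bool set)"
  define \<sigma> :: "bit_string \<Rightarrow> bit_string" where "\<sigma> s = s(i := (\<not> s i))" for s
  have invol: "\<sigma> (\<sigma> s) = s" for s
    by (simp add: \<sigma>_def)
  have closed: "\<sigma> s \<in> ?S" if "s \<in> ?S" for s
    using that assms by (simp add: \<sigma>_def PiE_dflt_def)
  have "\<sigma> ` ?S = ?S"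
  proof (intro equalityI image_subsetI subsetI)
    show "s \<in> \<sigma> ` ?S" if "s \<in> ?S" for s
      using closed[OF that] by (rule rev_image_eqI) (simp add: invol)
  qed (rule closed)
  moreover have "inj_on \<sigma> ?S"
    by (rule inj_on_inverseI[where g = \<sigma>]) (rule invol)
  moreover have "finite ?S" "?S \<noteq> {}"
    by (auto simp: finite_string_index intro!: finite_PiE_dflt)
  ultimately show ?thesis
    unfolding shared_string_def string_index_def[symmetric] \<sigma>_def[symmetric]
    by (subst map_pmf_of_set_inj) simp_all
qed

text \<open>
  Flipping the bit of a token in the symmetric difference preserves the distribution of the string
  and exchanges the event with its complement.
\<close>

lemma prob_sharedbit_tag_neq:
  assumes "A \<subseteq> {1..N}" "B \<subseteq> {1..N}" "A \<noteq> B" "1 \<le> r" "r \<le> c * N\<^sup>2"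
  shows "measure_pmf.prob (shared_string c N)
    {s. sharedbit_tag s r u A \<noteq> sharedbit_tag s r v B} = 1 / 2"
proof -
  let ?M = "measure_pmf.prob (shared_string c N)"
  let ?D = "{s. sharedbit_tag s r u A \<noteq> sharedbit_tag s r v B}"
  obtain t where t: "t \<in> (A - B) \<union> (B - A)"
    using assms(3) by blast
  let ?i = "(r, t, 0::nat)"
  let ?\<sigma> = "\<lambda>s::bit_string. s(?i := (\<not> s ?i))"
  have "finite A" "finite B"
    using assms finite_subset by blast+
  then have flip: "?\<sigma> s \<in> ?D \<longleftrightarrow> s \<notin> ?D" for s
    using t by (auto simp del: fun_upd_apply simp: sharedbit_tag_flip sharedbit_tag_upd_other)
  \<comment> \<open>The bounds on \<open>r\<close>, \<open>A\<close> and \<open>B\<close> are what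
    place the flipped position inside the string, where the bit is random and not the constant
    default.\<close>
  have index: "?i \<in> string_index c N"
    using t assms by (auto simp: string_index_def)
  have "?M ?D = measure_pmf.prob (map_pmf ?\<sigma> (shared_string c N)) ?D"
    unfolding map_shared_string_flip[OF index] ..
  also have "\<dots> = ?M (- ?D)"
    unfolding measure_map_pmf by (rule arg_cong[of _ _ ?M]) (use flip in blast)
  also have "\<dots> = 1 - ?M ?D"
    using measure_pmf.prob_compl[of ?D "shared_string c N"] by (simp add: Compl_eq_Diff_UNIV)
  finally show ?thesis
    by simp
qed


section \<open>One round\<close>

text \<open>Contrapositive: a function that agrees across every edge is constant along paths, hence
  on a connected graph.\<close>

lemma connected_graph_edge_neq:
  assumes "connected_graph V G" "u \<in> V" "v \<in> V" "h u \<noteq> h v"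
  obtains x y where "(x, y) \<in> G" "h x \<noteq> h y"
proof -
  have "(u, v) \<in> G\<^sup>*"
    using assms by (auto simp: connected_graph_def)
  then have "h u = h v" if "\<And>x y. (x, y) \<in> G \<Longrightarrow> h x = h y"
    by (induction rule: rtrancl_induct) (auto simp: that)
  with assms(4) that show thesis
    by blast
qed

lemma set_pmf_acceptD:
  assumes "Some u \<in> set_pmf (accept G p v)" "finite G"
  shows "p v = None" "(u, v) \<in> G" "p u = Some v"
proof -
  define R where "R = {u. (u, v) \<in> G \<and> p u = Some v}"
  \<comment> \<open>\<open>pmf_of_set\<close> is guaranteed to have the given set as its support
    only if that set is finite and nonempty.\<close>
  have "finite R"
    unfolding R_def by (rule finite_subset[of _ "fst ` G"]) (use assms(2) in force)+
  then have "p v = None \<and> u \<in> R"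
    using assms(1) unfolding accept_def Let_def R_def[symmetric] by (auto split: if_splits)
  then show "p v = None" "(u, v) \<in> G" "p u = Some v"
    by (auto simp: R_def)
qed

lemma None_in_set_pmf_acceptD:
  assumes "None \<in> set_pmf (accept G p v)" "(u, v) \<in> G" "p u = Some v"
  shows "p v \<noteq> None"
  using assms by (auto simp: accept_def Let_def split: if_splits)

text \<open>The progress argument quantifies over all possible proposals, so they are described
  through the support.\<close>

lemma set_pmf_sharedbit_propose:
  assumes "finite G"
  shows "set_pmf (sharedbit_propose \<omega> r u A (neighbor_view G tag u)) =
    (if sharedbit_tag \<omega> r u A \<and> (\<exists>v. (u, v) \<in> G \<and> \<not> tag v)
     then Some ` {v. (u, v) \<in> G \<and> \<not> tag v} else {None})"
proof -
  define Z where "Z = {v. (u, v) \<in> G \<and> \<not> tag v}"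
  have view: "{v. neighbor_view G tag u v = Some False} = Z"
    by (auto simp: neighbor_view_def Z_def)
  have "finite Z"
    unfolding Z_def by (rule finite_subset[of _ "snd ` G"]) (use assms in force)+
  moreover have "(\<exists>v. (u, v) \<in> G \<and> \<not> tag v) \<longleftrightarrow> Z \<noteq> {}"
    by (auto simp: Z_def)
  ultimately show ?thesis
    unfolding sharedbit_propose_def Let_def view Z_def[symmetric] by simp
qed

section \<open>The potential, the invariant and the progress of one round\<close>

definition missing :: "nat set \<Rightarrow> nat set \<Rightarrow> config \<Rightarrow> nat" where
  "missing V K T = (\<Sum>u\<in>V. card (K - T u))"

text \<open>The invariant of the run. The unique holder of \<open>gossip_instance\<close> is lost as
  soon as a token is copied; what survives is that some node holds it.\<close>

definition valid_config :: "nat set \<Rightarrow> nat set \<Rightarrow> config \<Rightarrow> bool" where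
  "valid_config V K T \<longleftrightarrow> (\<forall>u\<in>V. T u \<subseteq> K) \<and> (\<forall>t\<in>K. \<exists>u\<in>V. t \<in> T u)"

text \<open>The bound 1/2 on \<epsilon> gives each Transfer on different sets at least an even
  chance of success.\<close>

locale sharedbit_gossip =
  fixes N :: nat and V K :: "nat set" and \<epsilon> :: real
    and transfer :: "nat \<Rightarrow> nat \<Rightarrow> nat set \<Rightarrow> nat set \<Rightarrow> (nat set \<times> nat set) pmf"
  assumes V: "V \<subseteq> {1..N}" and K: "K \<subseteq> {1..N}"
    and transfer: "transfer_subroutine N \<epsilon> transfer" and eps: "\<epsilon> \<le> 1 / 2"
begin

lemma finite_V: "finite V" and finite_K: "finite K"
  using V K finite_subset by blast+

lemma missing_eq_0_iff: "missing V K T = 0 \<longleftrightarrow> (\<forall>u\<in>V. K \<subseteq> T u)"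
  by (auto simp: missing_def finite_V finite_K)

lemma missing_mono:
  assumes "\<And>u. T u \<subseteq> T' u"
  shows "missing V K T' \<le> missing V K T"
  unfolding missing_def using assms finite_K by (intro sum_mono card_mono) auto

lemma missing_strict_mono:
  assumes "\<And>u. T u \<subseteq> T' u" "u \<in> V" "t \<in> K" "t \<in> T' u" "t \<notin> T u"
  shows "missing V K T' < missing V K T"
  unfolding missing_def
proof (rule sum_strict_mono_ex1[OF finite_V])
  show "\<forall>x\<in>V. card (K - T' x) \<le> card (K - T x)"
    using assms(1) finite_K by (intro ballI card_mono) auto
  show "\<exists>x\<in>V. card (K - T' x) < card (K - T x)"
    using assms finite_K by (intro bexI[of _ u] psubset_card_mono) auto
qed

lemma finite_graph:
  assumes "connected_graph V G"
  shows "finite G"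
  using assms finite_V by (auto simp: connected_graph_def intro: finite_subset)

text \<open>This and the next two definitions name the stages of \<open>mtm_round\<close>, so that a
  round can be analyzed conditionally on the outcome of its earlier stages.\<close>

definition exchange :: "config \<Rightarrow> (nat \<Rightarrow> nat option) \<Rightarrow> (nat \<Rightarrow> nat set \<times> nat set) pmf" where
  "exchange T a = Pi_pmf V ({}, {})
     (\<lambda>v. case a v of None \<Rightarrow> return_pmf ({}, {}) | Some u \<Rightarrow> transfer u v (T u) (T v))"

definition outcome ::
  "config \<Rightarrow> (nat \<Rightarrow> nat option) \<Rightarrow> (nat \<Rightarrow> nat option) \<Rightarrow> (nat \<Rightarrow> nat set \<times> nat set) \<Rightarrow> config" where
  "outcome T p a x = (\<lambda>w. case a w of
       Some u \<Rightarrow> snd (x w)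
     | None \<Rightarrow> (case p w of
                 Some v \<Rightarrow> if a v = Some w then fst (x v) else T w
               | None \<Rightarrow> T w))"

definition proposals :: "nat rel \<Rightarrow> bit_string \<Rightarrow> nat \<Rightarrow> config \<Rightarrow> (nat \<Rightarrow> nat option) pmf" where
  "proposals G \<omega> r T = Pi_pmf V None (\<lambda>u. sharedbit_propose \<omega> r u (T u)
     (neighbor_view G (\<lambda>v. sharedbit_tag \<omega> r v (T v)) u))"

lemma sharedbit_round_eq:
  "sharedbit_round V G transfer \<omega> r T =
     do {
       p \<leftarrow> proposals G \<omega> r T;
       a \<leftarrow> Pi_pmf V None (accept G p);
       x \<leftarrow> exchange T a;
       return_pmf (outcome T p a x)
     }"
  unfolding sharedbit_round_def mtm_round_def proposals_def exchange_def outcome_def ..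

text \<open>Collects what an accepted proposal implies. The guarantees of Transfer require distinct
  nodes in \<open>{1..N}\<close> and token sets in the same range; the graph and the invariant
  provide these.\<close>

lemma accepted_exchange:
  assumes G: "connected_graph V G" and T: "valid_config V K T"
    and a: "a \<in> set_pmf (Pi_pmf V None (accept G p))" and x: "x \<in> set_pmf (exchange T a)"
    and av: "a v = Some u"
  shows "(u, v) \<in> G" "u \<in> V" "v \<in> V" "u \<noteq> v" "p v = None" "p u = Some v"
    "T u \<subseteq> fst (x v)" "fst (x v) \<subseteq> K" "T v \<subseteq> snd (x v)" "snd (x v) \<subseteq> K"
proof -
  \<comment> \<open>Outside \<open>V\<close> the product distribution returns its default
    \<open>None\<close>, so an acceptor must be a node.\<close>
  show "v \<in> V"
    using a av set_Pi_pmf_subset[OF finite_V] by force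
  then have "Some u \<in> set_pmf (accept G p v)"
    using a av by (auto simp: set_Pi_pmf[OF finite_V] PiE_dflt_def dest: bspec[of _ _ v])
  from set_pmf_acceptD[OF this finite_graph[OF G]]
  show uv: "(u, v) \<in> G" and "p v = None" "p u = Some v"
    by auto
  show "u \<in> V" "u \<noteq> v"
    using uv G by (auto simp: connected_graph_def irrefl_def)
  have mem: "x v \<in> set_pmf (transfer u v (T u) (T v))"
    using x \<open>v \<in> V\<close> av unfolding exchange_def
    by (auto simp: set_Pi_pmf[OF finite_V] PiE_dflt_def dest!: bspec[of _ _ v])
  have "T u \<subseteq> K" "T v \<subseteq> K"
    using T \<open>u \<in> V\<close> \<open>v \<in> V\<close> by (auto simp: valid_config_def)
  have "\<forall>(A', B')\<in>set_pmf (transfer u v (T u) (T v)).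
      T u \<subseteq> A' \<and> A' \<subseteq> T u \<union> T v \<and> T v \<subseteq> B' \<and> B' \<subseteq> T u \<union> T v"
    using transfer \<open>u \<in> V\<close> \<open>v \<in> V\<close> \<open>u \<noteq> v\<close> \<open>T u \<subseteq> K\<close> \<open>T v \<subseteq> K\<close> V K
    unfolding transfer_subroutine_def by (meson order_trans subsetD)
  from bspec[OF this mem] have "T u \<subseteq> fst (x v) \<and> fst (x v) \<subseteq> T u \<union> T v \<and>
      T v \<subseteq> snd (x v) \<and> snd (x v) \<subseteq> T u \<union> T v"
    by (auto simp: case_prod_beta)
  then show "T u \<subseteq> fst (x v)" "fst (x v) \<subseteq> K" "T v \<subseteq> snd (x v)" "snd (x v) \<subseteq> K"
    using \<open>T u \<subseteq> K\<close> \<open>T v \<subseteq> K\<close> by auto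
qed

text \<open>A node either keeps its set or takes its side of one exchange, and an exchange only adds
  tokens known to the partner.\<close>

lemma outcome_bounds:
  assumes "connected_graph V G" "valid_config V K T"
    "a \<in> set_pmf (Pi_pmf V None (accept G p))" "x \<in> set_pmf (exchange T a)"
  shows "T w \<subseteq> outcome T p a x w" "w \<in> V \<Longrightarrow> outcome T p a x w \<subseteq> K"
  using accepted_exchange[OF assms] assms(2)
  by (auto simp: outcome_def valid_config_def split: option.splits)

lemma round_preserves:
  assumes "connected_graph V G" "valid_config V K T"
    "T' \<in> set_pmf (sharedbit_round V G transfer \<omega> r T)"
  shows "valid_config V K T'" "missing V K T' \<le> missing V K T"
proof -
  obtain p a x where "a \<in> set_pmf (Pi_pmf V None (accept G p))" "x \<in> set_pmf (exchange T a)"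
    and T': "T' = outcome T p a x"
    using assms(3) unfolding sharedbit_round_eq by auto
  note * = outcome_bounds[OF assms(1,2) this(1,2), folded T']
  show "valid_config V K T'"
    using assms(2) * unfolding valid_config_def by (meson subsetD)
  show "missing V K T' \<le> missing V K T"
    using * by (intro missing_mono)
qed

text \<open>Whatever is proposed and accepted, some connection joins nodes with different tags. The
  bound is therefore shown for every fixed \<open>p\<close> and \<open>a\<close>, and only the
  randomness of Transfer remains.\<close>

lemma prob_missing_decreases_fixed_string:
  assumes G: "connected_graph V G" and T: "valid_config V K T"
    and edge: "(u, v) \<in> G" and tags: "sharedbit_tag \<omega> r u (T u)" "\<not> sharedbit_tag \<omega> r v (T v)"
  shows "1 / 2 \<le> measure_pmf.prob (sharedbit_round V G transfer \<omega> r T)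
    {T'. missing V K T' < missing V K T}"
  unfolding sharedbit_round_eq
proof (rule prob_bind_pmf_ge_UNIV, rule prob_bind_pmf_ge_UNIV)
  fix p a
  assume p: "p \<in> set_pmf (proposals G \<omega> r T)"
    and a: "a \<in> set_pmf (Pi_pmf V None (accept G p))"
  note fG = finite_graph[OF G]
  have GV: "x \<in> V" "y \<in> V" if "(x, y) \<in> G" for x y
    using that G by (auto simp: connected_graph_def)
  have p_cases: "p x \<in> (if sharedbit_tag \<omega> r x (T x) \<and> (\<exists>y. (x, y) \<in> G \<and> \<not> sharedbit_tag \<omega> r y (T y))
     then Some ` {y. (x, y) \<in> G \<and> \<not> sharedbit_tag \<omega> r y (T y)} else {None})" if "x \<in> V" for x
    using p that unfolding proposals_def set_Pi_pmf[OF finite_V] PiE_dflt_def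
    by (auto simp: set_pmf_sharedbit_propose[OF fG] dest: bspec[of _ _ x])
  \<comment> \<open>The neighbor chosen by \<open>u\<close> need not be \<open>v\<close>; it only
    has to advertise 0. The edge to \<open>v\<close> ensures that such a neighbor exists.\<close>
  obtain z where z: "p u = Some z" "(u, z) \<in> G" "\<not> sharedbit_tag \<omega> r z (T z)"
    using p_cases[of u] GV[OF edge] edge tags by (auto split: if_splits)
  then have zV: "z \<in> V" and pz: "p z = None"
    using GV p_cases[of z] by (auto split: if_splits)
  have "a z \<in> set_pmf (accept G p z)"
    using a zV by (auto simp: set_Pi_pmf[OF finite_V] PiE_dflt_def)
  \<comment> \<open>The accepted proposer \<open>w\<close> may differ from \<open>u\<close>, but
    having proposed, it advertises 1.\<close>
  then obtain w where w: "a z = Some w"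
    using None_in_set_pmf_acceptD[of G p z u] z pz by (cases "a z") auto
  let ?A = "T w" and ?B = "T z"
  let ?m = "Min ((?A \<union> ?B) - (?A \<inter> ?B))"
  let ?S = "{(A', B'). ?m \<in> A' \<inter> B'}"
  let ?D = "{x. x z \<in> ?S}"
  have "Some w \<in> set_pmf (accept G p z)"
    using \<open>a z \<in> _\<close> w by simp
  note wz = set_pmf_acceptD[OF this fG]
  have wV: "w \<in> V" and "w \<noteq> z"
    using GV[OF wz(2)] wz by auto
  have "sharedbit_tag \<omega> r w (T w)"
    using p_cases[OF wV] wz by (auto split: if_splits)
  \<comment> \<open>A tag is determined by the token set and the string, so different tags certify
    different sets.\<close>
  then have "?A \<noteq> ?B"
    using z(3) by (auto simp: sharedbit_tag_def)
  have AB: "?A \<subseteq> K" "?B \<subseteq> K"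
    using T wV zV by (auto simp: valid_config_def)
  have "?m \<in> (?A \<union> ?B) - (?A \<inter> ?B)"
    using \<open>?A \<noteq> ?B\<close> AB finite_K by (intro Min_in) (auto intro: finite_subset)
  then have m: "?m \<in> K" "?m \<notin> ?A \<or> ?m \<notin> ?B"
    using AB by auto
  have "1 / 2 \<le> 1 - \<epsilon>"
    using eps by simp
  also have "\<dots> \<le> measure_pmf.prob (transfer w z ?A ?B) ?S"
    using transfer \<open>?A \<noteq> ?B\<close> AB K V wV zV \<open>w \<noteq> z\<close> unfolding transfer_subroutine_def
    by (meson order_trans subsetD)
  \<comment> \<open>Exchanges are indexed by acceptors, so this Transfer is the component at
    \<open>z\<close> of the product.\<close>
  also have "transfer w z ?A ?B = map_pmf (\<lambda>x. x z) (exchange T a)"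
    unfolding exchange_def Pi_pmf_component[OF finite_V] using zV w by simp
  \<comment> \<open>The factor 1 fits \<open>prob_bind_pmf_ge\<close>: once this Transfer succeeds,
    the decrease is certain.\<close>
  also have "measure_pmf.prob \<dots> ?S = measure_pmf.prob (exchange T a) ?D * 1"
    by (simp add: vimage_def)
  also have "\<dots> \<le> measure_pmf.prob (bind_pmf (exchange T a) (\<lambda>x. return_pmf (outcome T p a x)))
      {T'. missing V K T' < missing V K T}"
  proof (rule prob_bind_pmf_ge)
    fix x assume x: "x \<in> set_pmf (exchange T a)" and "x \<in> ?D"
    then have xm: "?m \<in> fst (x z)" "?m \<in> snd (x z)"
      by (auto simp: case_prod_beta)
    \<comment> \<open>A proposer cannot also accept, so the new set of \<open>w\<close> is indeed
      the one coming from its exchange with \<open>z\<close>.\<close>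
    have "a w = None"
    proof (cases "a w")
      case (Some y)
      then show ?thesis
        using accepted_exchange(5)[OF G T a x Some] wz by simp
    qed
    then have "outcome T p a x w = fst (x z)" "outcome T p a x z = snd (x z)"
      using w wz by (simp_all add: outcome_def)
    then have "missing V K (outcome T p a x) < missing V K T"
      using m xm wV zV outcome_bounds(1)[OF G T a x] missing_strict_mono by metis
    then show "1 \<le> measure_pmf.prob (return_pmf (outcome T p a x)) {T'. missing V K T' < missing V K T}"
      by simp
  qed simp
  finally show "1 / 2 \<le> measure_pmf.prob (bind_pmf (exchange T a) (\<lambda>x. return_pmf (outcome T p a x)))
      {T'. missing V K T' < missing V K T}" .
qed simp_all

text \<open>A token known to one node and missing at another makes \<open>T\<close> nonconstant,
  hence nonconstant across an edge. The tags of its endpoints differ with probability 1/2, and then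
  whichever endpoint advertises 1 plays the proposer; this is why both orientations of the edge are
  kept.\<close>

lemma prob_missing_decreases:
  assumes G: "connected_graph V G" and T: "valid_config V K T"
    and pos: "0 < missing V K T" and r: "1 \<le> r" "r \<le> c * N\<^sup>2"
  shows "1 / 4 \<le> measure_pmf.prob
    (bind_pmf (shared_string c N) (\<lambda>\<omega>. sharedbit_round V G transfer \<omega> r T))
    {T'. missing V K T' < missing V K T}"
proof -
  obtain x t where "x \<in> V" "t \<in> K" "t \<notin> T x"
    using pos missing_eq_0_iff[of T] by auto
  moreover obtain y where "y \<in> V" "t \<in> T y"
    using T \<open>t \<in> K\<close> by (auto simp: valid_config_def)
  ultimately obtain u v where uv: "(u, v) \<in> G" and neq: "T u \<noteq> T v"
    using connected_graph_edge_neq[OF G, of x y T] by blast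
  then have vu: "(v, u) \<in> G" and "u \<in> V" "v \<in> V"
    using G by (auto simp: connected_graph_def dest: symD)
  let ?D = "{\<omega>. sharedbit_tag \<omega> r u (T u) \<noteq> sharedbit_tag \<omega> r v (T v)}"
  have "measure_pmf.prob (shared_string c N) ?D = 1 / 2"
    using T \<open>u \<in> V\<close> \<open>v \<in> V\<close> K neq r
    by (intro prob_sharedbit_tag_neq) (auto simp: valid_config_def subset_iff)
  then have "1 / 4 = measure_pmf.prob (shared_string c N) ?D * (1 / 2)"
    by simp
  also have "\<dots> \<le> measure_pmf.prob
    (bind_pmf (shared_string c N) (\<lambda>\<omega>. sharedbit_round V G transfer \<omega> r T))
    {T'. missing V K T' < missing V K T}"
    using prob_missing_decreases_fixed_string[OF G T uv] prob_missing_decreases_fixed_string[OF G T vu]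
    by (intro prob_bind_pmf_ge) auto
  finally show ?thesis .
qed

end


section \<open>The run as a Markov chain\<close>

lemma sharedbit_tag_cong:
  assumes "\<And>t. \<omega> (r, t, 0) = \<omega>' (r, t, 0)"
  shows "sharedbit_tag \<omega> r = sharedbit_tag \<omega>' r"
  using assms by (simp add: sharedbit_tag_def fun_eq_iff)

lemma sharedbit_round_cong:
  assumes "\<And>t. \<omega> (r, t, 0) = \<omega>' (r, t, 0)"
  shows "sharedbit_round V G transfer \<omega> r = sharedbit_round V G transfer \<omega>' r"
proof -
  have tag: "sharedbit_tag \<omega> r = sharedbit_tag \<omega>' r"
    using assms by (rule sharedbit_tag_cong)
  have "sharedbit_propose \<omega> r = sharedbit_propose \<omega>' r"
    unfolding sharedbit_propose_def tag ..
  with tag show ?thesis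
    unfolding sharedbit_round_def by simp
qed

text \<open>Each round reads only its own group. The bound on \<open>r\<close> excludes
  \<open>late\<close>, which may depend on the whole string.\<close>

lemma sharedbit_config_cong:
  assumes "\<And>q t i. q \<le> r \<Longrightarrow> \<omega> (q, t, i) = \<omega>' (q, t, i)" "r \<le> c * N\<^sup>2"
  shows "sharedbit_config c N V E transfer late T1 \<omega> r =
    sharedbit_config c N V E transfer late T1 \<omega>' r"
  using assms
proof (induction r)
  case (Suc r)
  have "sharedbit_round V G transfer \<omega> (Suc r) = sharedbit_round V G transfer \<omega>' (Suc r)" for G
    using Suc.prems(1) by (intro sharedbit_round_cong) simp
  with Suc show ?case
    by simp
qed simp

text \<open>The string is drawn once for all rounds, but the current configuration depends only on
  groups already read. Redrawing the string in each round thus gives the same distribution, and the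
  run becomes a Markov chain.\<close>

lemma sharedbit_run_Suc:
  assumes "Suc r \<le> c * N\<^sup>2"
  shows "sharedbit_run c N V E transfer late T1 (Suc r) =
    bind_pmf (sharedbit_run c N V E transfer late T1 r)
      (\<lambda>T. bind_pmf (shared_string c N) (\<lambda>\<omega>. sharedbit_round V (E (Suc r)) transfer \<omega> (Suc r) T))"
proof -
  have "sharedbit_run c N V E transfer late T1 (Suc r) = bind_pmf (shared_string c N)
      (\<lambda>\<omega>. bind_pmf (sharedbit_config c N V E transfer late T1 \<omega> r)
        (sharedbit_round V (E (Suc r)) transfer \<omega> (Suc r)))"
    using assms by (simp add: sharedbit_run_def)
  also have "\<dots> = bind_pmf (sharedbit_run c N V E transfer late T1 r)
      (\<lambda>T. bind_pmf (shared_string c N) (\<lambda>\<omega>. sharedbit_round V (E (Suc r)) transfer \<omega> (Suc r) T))"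
    unfolding sharedbit_run_def
  proof (rule bind_shared_string_resample[where r = r])
    show "sharedbit_config c N V E transfer late T1 \<omega> r = sharedbit_config c N V E transfer late T1 \<omega>' r"
      if "\<And>q t i. q \<le> r \<Longrightarrow> \<omega> (q, t, i) = \<omega>' (q, t, i)" for \<omega> \<omega>'
      using that assms by (intro sharedbit_config_cong) auto
    show "sharedbit_round V (E (Suc r)) transfer \<omega> (Suc r) T =
        sharedbit_round V (E (Suc r)) transfer \<omega>' (Suc r) T"
      if "\<And>q t i. r < q \<Longrightarrow> \<omega> (q, t, i) = \<omega>' (q, t, i)" for \<omega> \<omega>' T
      using sharedbit_round_cong[of \<omega> "Suc r" \<omega>'] that by simp
  qed
  finally show ?thesis .
qed

section \<open>Tail bound for the run and choice of the constants\<close>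

lemma (in sharedbit_gossip) prob_unfinished:
  assumes E: "dynamic_graph V E" and T1: "valid_config V K T1" and f: "f \<le> c * N\<^sup>2"
  shows "measure_pmf.prob (sharedbit_run c N V E transfer late T1 f) {T. 0 < missing V K T}
    \<le> (7 / 8) ^ f * 2 ^ missing V K T1"
proof -
  have G: "connected_graph V (E (Suc r))" for r
    using E by (simp add: dynamic_graph_def)
  \<comment> \<open>The tail bound with \<open>p = 1 / 4\<close>, the progress probability of one
    round; its factor is 7/8.\<close>
  have "measure_pmf.prob (sharedbit_run c N V E transfer late T1 f) {T. 0 < missing V K T}
      \<le> (1 - (1 / 4) / 2) ^ f * 2 ^ missing V K T1"
  proof (rule potential_tail_bound[where I = "valid_config V K" and Q = "\<lambda>r T.
        bind_pmf (shared_string c N) (\<lambda>\<omega>. sharedbit_round V (E (Suc r)) transfer \<omega> (Suc r) T)"])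
    show "sharedbit_run c N V E transfer late T1 0 = return_pmf T1"
      by (simp add: sharedbit_run_def)
    show "1 / 4 \<le> measure_pmf.prob
        (bind_pmf (shared_string c N) (\<lambda>\<omega>. sharedbit_round V (E (Suc r)) transfer \<omega> (Suc r) T))
        {T'. missing V K T' < missing V K T}"
      if "r < f" "valid_config V K T" "0 < missing V K T" for r T
      using that f by (intro prob_missing_decreases[OF G]) auto
  qed (use f T1 round_preserves[OF G] in \<open>auto intro!: sharedbit_run_Suc\<close>)
  then show ?thesis
    by simp
qed

theorem theorem5p1:
  shows "\<exists>(C::nat) (c0::nat) (ct0::real). \<forall>c\<ge>c0. \<forall>ct\<ge>ct0.
    \<forall>(N::nat) (n::nat) (k::nat) (\<tau>::enat) V E K T1 transfer late.
      1 < n \<and> n \<le> N \<and> 1 \<le> k \<and> k \<le> n \<and> card V = n \<and> card K = k \<and>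
      gossip_instance N V K T1 \<and>
      dynamic_graph V E \<and> 1 \<le> \<tau> \<and> stability_factor \<tau> E \<and>
      transfer_subroutine N (real n powr (- ct)) transfer \<longrightarrow>
      solves_gossip V K (sharedbit_run c N V E transfer late T1) (C * k * n)"
\<comment> \<open>The same 12 serves as \<open>C\<close> and as \<open>c0\<close>: with
  \<open>c\<close> at least 12 the string outlasts all \<open>12 * k * n\<close> rounds. The
  exponent bound 1 brings the failure probability of Transfer to at most \<open>1 / n\<close>, hence
  to 1/2.\<close>
proof (intro exI[of _ "12::nat"] exI[of _ "1::real"] allI impI, elim conjE)
  fix c :: nat and ct :: real and N n k :: nat and \<tau> :: enat and V E K T1 transfer late
  assume c: "12 \<le> c" and ct: "1 \<le> ct" and n: "1 < n" "n \<le> N" and k: "1 \<le> k" "k \<le> n"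
    and card: "card V = n" "card K = k" and inst: "gossip_instance N V K T1"
    and E: "dynamic_graph V E" and transfer: "transfer_subroutine N (real n powr (- ct)) transfer"
  have "real n powr (- ct) \<le> real n powr (- 1)"
    using ct n by (intro powr_mono) auto
  also have "\<dots> \<le> 1 / 2"
    using n by (simp add: powr_minus_divide field_simps)
  finally have eps: "real n powr (- ct) \<le> 1 / 2" .
  interpret sharedbit_gossip N V K "real n powr (- ct)" transfer
    using inst transfer eps by unfold_locales (auto simp: gossip_instance_def)
  have T1: "valid_config V K T1"
    using inst by (auto simp: gossip_instance_def valid_config_def)
  let ?P = "measure_pmf.prob (sharedbit_run c N V E transfer late T1 (12 * k * n))"
  \<comment> \<open>Both \<open>k\<close> and \<open>n\<close> are at most \<open>N\<close>, so the
    analyzed rounds end before \<open>late\<close> takes over.\<close>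
  have "12 * (k * n) \<le> c * (N * N)"
    using c k n by (intro mult_le_mono) auto
  then have f: "12 * k * n \<le> c * N\<^sup>2"
    by (simp add: power2_eq_square mult.assoc)
  have "missing V K T1 \<le> (\<Sum>u\<in>V. k)"
    unfolding missing_def using card finite_K by (intro sum_mono) (auto intro: card_mono)
  then have init: "missing V K T1 \<le> k * n"
    using card by (simp add: mult.commute)
  have "?P {T. 0 < missing V K T} \<le> (7 / 8) ^ (12 * k * n) * 2 ^ missing V K T1"
    using prob_unfinished[OF E T1 f] .
  also have "\<dots> \<le> (7 / 8) ^ (12 * k * n) * 2 ^ (k * n)"
    using init by (intro mult_left_mono power_increasing) auto
  also have "\<dots> = ((7 / 8) ^ 12 * 2) ^ (k * n)"
    by (simp only: power_mult power_mult_distrib mult.assoc)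
  also have "\<dots> \<le> (1 / 2) ^ (k * n)"
    by (intro power_mono) (simp_all add: power_divide)
  \<comment> \<open>Since \<open>k\<close> is at least 1, the exponent is at least \<open>n\<close>,
    and \<open>2 ^ n\<close> exceeds \<open>n\<close>.\<close>
  also have "\<dots> \<le> (1 / 2) ^ n"
    using k by (intro power_decreasing) auto
  also have "\<dots> \<le> 1 / n"
    using n of_nat_less_two_power[of n, where ?'a = real] by (simp add: power_one_over field_simps)
  finally have "?P {T. 0 < missing V K T} \<le> 1 / n" .
  moreover have "?P {T. \<forall>u\<in>V. K \<subseteq> T u} = 1 - ?P {T. 0 < missing V K T}"
  proof -
    have "{T. \<forall>u\<in>V. K \<subseteq> T u} = UNIV - {T. 0 < missing V K T}"
      by (auto simp flip: missing_eq_0_iff)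
    then show ?thesis
      using measure_pmf.prob_compl[of "{T. 0 < missing V K T}"] by simp
  qed
  ultimately show "solves_gossip V K (sharedbit_run c N V E transfer late T1) (12 * k * n)"
    unfolding solves_gossip_def card by simp
qed

end
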